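(* There exists an absolute constant $c>0$ such that the following holds. Let $n$ be a positive integer, let $\delta>0$ be real, and let $A \subset \{0,1\}^{n}$ have size $2^{t}$ for some $t \in \mathbb{N}$. If $A$ cannot be made into a subcube by fewer than $\delta |A|$ additions and deletions, then \[|\partial A| \geq |A| \log_{2}(2^{n}/|A|) + |A| \min\{\delta \log_{2}(1/\delta),c\} = 2^{t}\left(n-t+\min\{\delta \log_{2}(1/\delta),c\}\right).\] Moreover, there exists an absolute constant $c'>0$ such that for all such $n$, $t$, $A$ and $\delta$ (that is, $|A|=2^t$ and $A$ cannot be made into a subcube by fewer than $\delta|A|$ additions and deletions), if $\delta \leq c'$, then \[|\partial A| \geq |A| \log_{2}(2^{n}/|A|) + |A| \delta \log_{2}(1/\delta) = 2^{t}(n-t+\delta \log_{2}(1/\delta)).\]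
   Context: $Q_n$ denotes the $n$-dimensional hypercube graph: its vertex set is $\{0,1\}^n$, and two 0-1 vectors are joined if and only if they differ in exactly one coordinate. For $A \subset \{0,1\}^n$, the edge-boundary $\partial A$ is the set of all edges of $Q_n$ joining a point in $A$ to a point not in $A$. A subcube of $\{0,1\}^n$ is a set of the form $\{x \in \{0,1\}^{n}: x_{i_1}=a_1,\ldots,x_{i_{m}}=a_{m}\}$, where $0 \leq m \leq n$, $i_1<\cdots<i_m$ are coordinates in $[n]=\{1,\ldots,n\}$, and $a_1,\ldots,a_m\in\{0,1\}$ are fixed. The statement "$A$ cannot be made into a subcube by fewer than $\delta|A|$ additions and deletions" means that $|A \Delta C| \geq \delta |A|$ for every subcube $C$ of $\{0,1\}^n$, where $\Delta$ denotes symmetric difference. *)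

theory Defs
  imports Complex_Main "HOL-Library.FuncSet"
begin

(* The dimension is a term, not a type, so that constants can be quantified before it.
   Points are extensional functions, so that distinct points differ on {1..n}. *)
definition cube :: "nat \<Rightarrow> (nat \<Rightarrow> nat) set" where
  "cube n = {1..n} \<rightarrow>\<^sub>E {0, 1}"

definition hypercube_edges :: "nat \<Rightarrow> (nat \<Rightarrow> nat) set set" where
  "hypercube_edges n =
     {{x, y} | x y. x \<in> cube n \<and> y \<in> cube n \<and> (\<exists>!i. i \<in> {1..n} \<and> x i \<noteq> y i)}"

definition edge_boundary :: "nat \<Rightarrow> (nat \<Rightarrow> nat) set \<Rightarrow> (nat \<Rightarrow> nat) set set" where
  "edge_boundary n A = {e \<in> hypercube_edges n. \<exists>x y. e = {x, y} \<and> x \<in> A \<and> y \<notin> A}"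

definition is_subcube :: "nat \<Rightarrow> (nat \<Rightarrow> nat) set \<Rightarrow> bool" where
  "is_subcube n C \<longleftrightarrow>
     (\<exists>I a. I \<subseteq> {1..n} \<and> a \<in> I \<rightarrow> {0, 1} \<and> C = {x \<in> cube n. \<forall>i\<in>I. x i = a i})"

definition far_from_subcubes :: "nat \<Rightarrow> real \<Rightarrow> (nat \<Rightarrow> nat) set \<Rightarrow> bool" where
  "far_from_subcubes n \<delta> A \<longleftrightarrow>
     (\<forall>C. is_subcube n C \<longrightarrow> real (card (sym_diff A C)) \<ge> \<delta> * real (card A))"

end

theory Submission
  imports Defs "HOL-Analysis.Harmonic_Numbers"
begin

text \<open>
  Write \<open>e\<close> for the number of edges inside a set \<open>A\<close> of vertices. Counting the \<open>n\<close> edges at every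
  vertex gives \<open>|\<partial>A| = n |A| - 2 e\<close>, so \<open>|\<partial>A| = |A| log (2^n / |A|) + ex A\<close> with the excess
  \<open>ex A = |A| log |A| - 2 e\<close> (logarithms to base 2). The edge-isoperimetric inequality says
  \<open>ex A \<ge> 0\<close> (\<open>excess_nonneg\<close>), and the theorem is a stability version of it. There are two ingredients.

  Exact bound near a subcube. Let \<open>C\<close> be a subcube of dimension \<open>s\<close>, and let \<open>A\<close> arise from \<open>C\<close> by
  deleting \<open>D\<close> and adding \<open>D'\<close>. Inside \<open>C\<close> every vertex has \<open>s\<close> neighbours, and a vertex outside
  \<open>C\<close> has at most one neighbour in \<open>C\<close>. Together with the isoperimetric inequality for \<open>D\<close> and \<open>D'\<close>
  this bounds \<open>e\<close> from above (\<open>arcs_le_near_subcube\<close>). If \<open>|A| = |C|\<close> and \<open>\<gamma> = |A \<Delta> C| / |A|\<close>, the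
  bound reads \<open>ex A \<ge> |A| \<gamma> log (1 / \<gamma>)\<close>, with the right constant
  (\<open>excess_ge_of_subcube_same_size\<close>). As \<open>\<gamma> log (1 / \<gamma>)\<close> increases for \<open>\<gamma> \<le> 1/8\<close>, this settles
  every \<open>A\<close> that has a subcube of its own size within distance \<open>|A| / 8\<close>.

  Rough stability. If \<open>ex A \<le> |A| / 36\<close>, then some subcube \<open>C\<close> satisfies \<open>|A \<Delta> C| \<le> |C| / 8\<close>
  (\<open>small_excess_near_subcube\<close>); when \<open>|A|\<close> is a power of two, this forces \<open>|C| = |A|\<close>. The proof is
  an induction on \<open>|A|\<close> that cuts \<open>A\<close> along a coordinate. The excess controls the unevenness of the
  cut: either one part is tiny, or both parts have nearly equal size and nearly agree after a flip of
  that coordinate. In the first case a subcube near the large part serves, in the second case a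
  subcube near one part is doubled. Errors do not build up along the induction, because a subcube at
  distance at most \<open>|C| / 8\<close> is already at distance at most \<open>ex A\<close> (\<open>sym_diff_le_excess\<close>).
\<close>

section \<open>Arcs of the cube\<close>

definition flip :: "nat \<Rightarrow> (nat \<Rightarrow> nat) \<Rightarrow> nat \<Rightarrow> nat" where
  "flip i x = x(i := 1 - x i)"

lemma finite_cube [simp]: "finite (cube n)"
  unfolding cube_def by (intro finite_PiE) auto

lemma finite_subset_cube: "A \<subseteq> cube n \<Longrightarrow> finite A"
  by (rule finite_subset[OF _ finite_cube])

lemma cube_value: "x \<in> cube n \<Longrightarrow> i \<in> {1..n} \<Longrightarrow> x i = 0 \<or> x i = 1"
  unfolding cube_def using PiE_mem[of x "{1..n}" "\<lambda>_. {0, 1}" i] by simp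

lemma flip_in_cube: "x \<in> cube n \<Longrightarrow> i \<in> {1..n} \<Longrightarrow> flip i x \<in> cube n"
  unfolding cube_def flip_def PiE_def Pi_def extensional_def by auto

lemma flip_flip: "x \<in> cube n \<Longrightarrow> i \<in> {1..n} \<Longrightarrow> flip i (flip i x) = x"
  using cube_value[of x n i] by (auto simp: flip_def fun_eq_iff)

lemma flip_other: "j \<noteq> i \<Longrightarrow> flip i x j = x j"
  by (simp add: flip_def)

lemma flip_same_neq: "flip i x i \<noteq> x i"
  by (cases "x i") (auto simp: flip_def)

lemma flip_index_inj: "flip i x = flip j x \<Longrightarrow> i = j"
  by (metis flip_other flip_same_neq)

lemma inj_on_flip: "A \<subseteq> cube n \<Longrightarrow> i \<in> {1..n} \<Longrightarrow> inj_on (flip i) A"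
  by (metis flip_flip inj_onI subsetD)

lemma cube_eqI:
  assumes "x \<in> cube n" "y \<in> cube n" "\<And>i. i \<in> {1..n} \<Longrightarrow> x i = y i"
  shows "x = y"
  using assms unfolding cube_def by (metis PiE_ext)

text \<open>
  Pairs of a vertex of \<open>A\<close> and a direction that leads from it into \<open>B\<close>. Thus \<open>arcs n A A\<close> counts every
  edge inside \<open>A\<close> twice, and \<open>arcs\<close> is additive in each argument on disjoint unions.
\<close>
definition arcs :: "nat \<Rightarrow> (nat \<Rightarrow> nat) set \<Rightarrow> (nat \<Rightarrow> nat) set \<Rightarrow> nat" where
  "arcs n A B = (\<Sum>i\<in>{1..n}. card {x \<in> A. flip i x \<in> B})"

lemma arcs_Un_left:
  assumes "finite A" "finite B" "A \<inter> B = {}"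
  shows "arcs n (A \<union> B) C = arcs n A C + arcs n B C"
proof -
  have "card {x \<in> A \<union> B. flip i x \<in> C} = card {x \<in> A. flip i x \<in> C} + card {x \<in> B. flip i x \<in> C}" for i
  proof -
    have "{x \<in> A \<union> B. flip i x \<in> C} = {x \<in> A. flip i x \<in> C} \<union> {x \<in> B. flip i x \<in> C}" by auto
    then show ?thesis using assms by (simp add: card_Un_disjoint disjoint_iff)
  qed
  then show ?thesis by (simp add: arcs_def sum.distrib)
qed

lemma arcs_Un_right:
  assumes "finite A" "B \<inter> C = {}"
  shows "arcs n A (B \<union> C) = arcs n A B + arcs n A C"
proof -
  have "card {x \<in> A. flip i x \<in> B \<union> C} = card {x \<in> A. flip i x \<in> B} + card {x \<in> A. flip i x \<in> C}" for i
  proof -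
    have "{x \<in> A. flip i x \<in> B \<union> C} = {x \<in> A. flip i x \<in> B} \<union> {x \<in> A. flip i x \<in> C}" by auto
    then show ?thesis using assms by (simp add: card_Un_disjoint disjoint_iff)
  qed
  then show ?thesis by (simp add: arcs_def sum.distrib)
qed

lemma arcs_mono_right: "finite A \<Longrightarrow> B \<subseteq> C \<Longrightarrow> arcs n A B \<le> arcs n A C"
  unfolding arcs_def by (intro sum_mono card_mono) auto

lemma card_flip_commute:
  assumes "A \<subseteq> cube n" "B \<subseteq> cube n" "i \<in> {1..n}"
  shows "card {x \<in> A. flip i x \<in> B} = card {x \<in> B. flip i x \<in> A}"
proof (rule bij_betw_same_card[of "flip i"])
  show "bij_betw (flip i) {x \<in> A. flip i x \<in> B} {x \<in> B. flip i x \<in> A}"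
    by (rule bij_betw_byWitness[where f' = "flip i"]) (use assms flip_flip in auto)
qed

lemma arcs_commute: "A \<subseteq> cube n \<Longrightarrow> B \<subseteq> cube n \<Longrightarrow> arcs n A B = arcs n B A"
  unfolding arcs_def by (intro sum.cong refl card_flip_commute)

lemma arcs_Un_self:
  assumes "A \<subseteq> cube n" "B \<subseteq> cube n" "A \<inter> B = {}"
  shows "arcs n (A \<union> B) (A \<union> B) = arcs n A A + 2 * arcs n A B + arcs n B B"
  using assms
  by (simp add: arcs_Un_left arcs_Un_right finite_subset_cube arcs_commute[of B n A])

lemma arcs_cube:
  assumes "A \<subseteq> cube n"
  shows "arcs n A (cube n) = n * card A"
proof -
  have "{x \<in> A. flip i x \<in> cube n} = A" if "i \<in> {1..n}" for i
    using assms that flip_in_cube by blast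
  then show ?thesis by (simp add: arcs_def)
qed

lemma card_edge_boundary_arcs:
  assumes "A \<subseteq> cube n"
  shows "card (edge_boundary n A) = arcs n A (cube n - A)"
proof -
  \<comment> \<open>A boundary edge has exactly one endpoint in \<open>A\<close>, so it comes from exactly one arc.\<close>
  let ?P = "SIGMA i:{1..n}. {x \<in> A. flip i x \<in> cube n - A}"
  have "bij_betw (\<lambda>(i, x). {x, flip i x}) ?P (edge_boundary n A)"
  proof (rule bij_betwI')
    fix p q assume p: "p \<in> ?P" and q: "q \<in> ?P"
    obtain i x where px: "p = (i, x)" by force
    obtain j y where qy: "q = (j, y)" by force
    show "((case p of (i, x) \<Rightarrow> {x, flip i x}) = (case q of (i, x) \<Rightarrow> {x, flip i x})) = (p = q)"
    proof
      assume "(case p of (i, x) \<Rightarrow> {x, flip i x}) = (case q of (i, x) \<Rightarrow> {x, flip i x})"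
      then have "{x, flip i x} = {y, flip j y}" using px qy by simp
      moreover have "x \<in> A" "flip i x \<notin> A" "y \<in> A" "flip j y \<notin> A" using p q px qy by auto
      ultimately have "x = y \<and> flip i x = flip j y" unfolding doubleton_eq_iff by metis
      then show "p = q" using flip_index_inj px qy by blast
    qed auto
  next
    fix p assume p: "p \<in> ?P"
    obtain i x where px: "p = (i, x)" by force
    have x: "i \<in> {1..n}" "x \<in> A" "flip i x \<in> cube n" "flip i x \<notin> A" using p px by auto
    have "\<exists>!k. k \<in> {1..n} \<and> x k \<noteq> flip i x k"
      using x(1) flip_other flip_same_neq by metis
    then have "{x, flip i x} \<in> hypercube_edges n"
      unfolding hypercube_edges_def using x assms by blast
    then show "(case p of (i, x) \<Rightarrow> {x, flip i x}) \<in> edge_boundary n A"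
      unfolding edge_boundary_def using x px by auto
  next
    fix e assume "e \<in> edge_boundary n A"
    then obtain x y where e: "e = {x, y}" "x \<in> A" "y \<notin> A" and "e \<in> hypercube_edges n"
      unfolding edge_boundary_def by auto
    then obtain u v where uv: "e = {u, v}" "u \<in> cube n" "v \<in> cube n"
      "\<exists>!i. i \<in> {1..n} \<and> u i \<noteq> v i" unfolding hypercube_edges_def by blast
    have "{x, y} = {u, v}" using e(1) uv(1) by simp
    then have "(x = u \<and> y = v) \<or> (x = v \<and> y = u)" by (rule doubleton_eq_iff[THEN iffD1])
    moreover have "\<exists>!i. i \<in> {1..n} \<and> v i \<noteq> u i" using uv(4) by (subst neq_commute)
    ultimately have xy: "x \<in> cube n" "y \<in> cube n" "\<exists>!i. i \<in> {1..n} \<and> x i \<noteq> y i"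
      using uv(2-4) by blast+
    then obtain i where i: "i \<in> {1..n}" "x i \<noteq> y i"
      and un: "\<And>j. j \<in> {1..n} \<Longrightarrow> x j \<noteq> y j \<Longrightarrow> j = i" by blast
    have "flip i x = y"
    proof (rule cube_eqI[of _ n])
      fix j assume j: "j \<in> {1..n}"
      show "flip i x j = y j"
      proof (cases "j = i")
        case True
        then show ?thesis
          using cube_value[OF xy(1) i(1)] cube_value[OF xy(2) i(1)] i(2) by (auto simp: flip_def)
      next
        case False
        then show ?thesis using un[OF j] flip_other by metis
      qed
    qed (use xy flip_in_cube i in auto)
    then show "\<exists>p\<in>?P. e = (case p of (i, x) \<Rightarrow> {x, flip i x})"
      using e xy i by (intro bexI[of _ "(i, x)"]) auto
  qed
  then have "card (edge_boundary n A) = card ?P" by (simp add: bij_betw_same_card)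
  also have "\<dots> = arcs n A (cube n - A)"
    unfolding arcs_def using assms finite_subset_cube by (subst card_SigmaI) auto
  finally show ?thesis .
qed

section \<open>The isoperimetric excess\<close>

definition excess :: "nat \<Rightarrow> (nat \<Rightarrow> nat) set \<Rightarrow> real" where
  "excess n A = real (card A) * log 2 (real (card A)) - real (arcs n A A)"

lemma card_edge_boundary_excess:
  assumes "A \<subseteq> cube n" "A \<noteq> {}"
  shows "real (card (edge_boundary n A)) = real (card A) * log 2 (2 ^ n / real (card A)) + excess n A"
proof -
  have fin: "finite A" using assms finite_subset_cube by blast
  have pos: "card A > 0" using assms fin by (simp add: card_gt_0_iff)
  have "A \<union> (cube n - A) = cube n" using assms by auto
  then have "n * card A = arcs n A A + arcs n A (cube n - A)"
    using arcs_Un_right[OF fin, of A "cube n - A" n] arcs_cube[OF assms(1)] by auto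
  then have B: "real (arcs n A (cube n - A)) = real n * real (card A) - real (arcs n A A)"
    by (metis add_diff_cancel_left' of_nat_add of_nat_mult)
  have L: "log 2 (2 ^ n / real (card A)) = real n - log 2 (real (card A))"
    using pos by (simp add: log_divide log_nat_power)
  show ?thesis
    unfolding card_edge_boundary_arcs[OF assms(1)] excess_def L B by (simp add: algebra_simps)
qed

text \<open>
  Dividing by \<open>x + y\<close> and putting \<open>p = x / (x + y)\<close>, this is a quantitative form of
  \<open>H(p) \<ge> 2 p\<close> for the binary entropy \<open>H\<close> and \<open>p \<le> 1/2\<close>. Equality holds only for \<open>p = 0\<close> and
  \<open>p = 1/2\<close>, so a small left-hand side forces \<open>p\<close> to be near one of these. Both cases use only
  \<open>ln z \<le> z - 1\<close>: near \<open>0\<close> it is applied to \<open>1 - p\<close>, near \<open>1/2\<close> to \<open>2 p\<close> and \<open>2 (1 - p)\<close>.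
\<close>
lemma entropy_gap:
  fixes x y :: real
  assumes "0 < x" "x \<le> y"
  shows "(x + y) * log 2 (x + y) - x * log 2 x - y * log 2 y - 2 * x
           \<ge> (if 3 * x \<le> y then x else (y - x) / 4)"
proof -
  let ?N = "x + y"
  have N: "?N > 0" "y > 0" using assms by auto
  have l2: "ln (2::real) \<ge> 2/3" "ln (2::real) \<le> 25/36" "ln (2::real) > 0"
    using ln2_ge_two_thirds ln2_le_25_over_36 by auto
  define h where "h = x * ln (?N / x) + y * ln (?N / y)"
  have h: "(x + y) * log 2 (x + y) - x * log 2 x - y * log 2 y = h / ln 2"
    unfolding h_def log_def using assms N by (simp add: ln_div field_simps)
  show ?thesis
  proof (cases "3 * x \<le> y")
    case True
    have "ln (4::real) \<le> ln (?N / x)"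
      using True assms N by (subst ln_le_cancel_iff) (auto simp: field_simps)
    moreover have "ln (4::real) = 2 * ln 2"
      using ln_realpow[of 2 2] by simp
    ultimately have a: "x * ln (?N / x) \<ge> x * (2 * ln 2)" using assms by simp
    have "ln (y / ?N) \<le> y / ?N - 1" using N by (intro ln_le_minus_one) auto
    moreover have "ln (?N / y) = - ln (y / ?N)" using N by (simp add: ln_div)
    ultimately have "ln (?N / y) \<ge> x / ?N" using N by (simp add: field_simps)
    then have "y * ln (?N / y) \<ge> y * (x / ?N)" using N by (intro mult_left_mono) auto
    moreover have "y * (x / ?N) \<ge> 3/4 * x" using True assms N by (simp add: field_simps)
    moreover have "x * ln 2 \<le> x * (25/36)" using l2 assms by (intro mult_left_mono) auto
    ultimately have "y * ln (?N / y) \<ge> x * ln 2" using assms by linarith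
    with a have "h \<ge> 3 * x * ln 2" unfolding h_def by (simp add: algebra_simps)
    then have "h / ln 2 \<ge> 3 * x" using l2 by (simp add: field_simps)
    with True show ?thesis unfolding h by simp
  next
    case False
    define u where "u = (y - x) / ?N"
    have u: "u \<le> 1/2" unfolding u_def using False N by (simp add: field_simps)
    have "ln (2 * x / ?N) \<le> 2 * x / ?N - 1" using N assms by (intro ln_le_minus_one) auto
    moreover have "ln (?N / x) = ln 2 - ln (2 * x / ?N)" using N assms by (simp add: ln_div ln_mult)
    moreover have "2 * x / ?N - 1 = - u" unfolding u_def using N by (simp add: field_simps)
    ultimately have "ln (?N / x) \<ge> ln 2 + u" by linarith
    then have a: "x * ln (?N / x) \<ge> x * (ln 2 + u)" using assms by simp
    have "ln (2 * y / ?N) \<le> 2 * y / ?N - 1" using N assms by (intro ln_le_minus_one) auto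
    moreover have "ln (?N / y) = ln 2 - ln (2 * y / ?N)" using N assms by (simp add: ln_div ln_mult)
    moreover have "2 * y / ?N - 1 = u" unfolding u_def using N by (simp add: field_simps)
    ultimately have "ln (?N / y) \<ge> ln 2 - u" by linarith
    then have "y * ln (?N / y) \<ge> y * (ln 2 - u)" using N by simp
    with a have "h \<ge> 2 * x * ln 2 + (y - x) * (ln 2 - u)"
      unfolding h_def by (simp add: algebra_simps)
    moreover have "(y - x) * (ln 2 - u) \<ge> (y - x) * (ln 2 / 4)"
      using assms u l2 by (intro mult_left_mono) auto
    ultimately have "h \<ge> (2 * x + (y - x) / 4) * ln 2" by (simp add: algebra_simps)
    then have "h / ln 2 \<ge> 2 * x + (y - x) / 4" using l2 by (simp add: field_simps)
    then show ?thesis unfolding h if_not_P[OF False] by linarith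
  qed
qed

text \<open>
  Only direction \<open>i\<close> joins the two parts of the cut, and it does so by a matching of \<open>m\<close> edges. So the
  excess of \<open>A\<close> pays for the two parts, for the vertices of the smaller part that are left unmatched,
  and for the unevenness of the cut.
\<close>
lemma excess_split:
  fixes b :: nat
  assumes "A \<subseteq> cube n" "i \<in> {1..n}"
    and P: "P = {x \<in> A. x i = b}" and Q: "Q = {x \<in> A. x i \<noteq> b}"
    and "P \<noteq> {}" "Q \<noteq> {}"
  defines "x \<equiv> min (real (card P)) (real (card Q))"
    and "y \<equiv> max (real (card P)) (real (card Q))"
    and "m \<equiv> real (card {z \<in> P. flip i z \<in> Q})"
  shows "m \<le> x"
    and "excess n A \<ge> excess n P + excess n Q + 2 * (x - m) + (if 3 * x \<le> y then x else (y - x) / 4)"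
    and "excess n A \<ge> excess n P + excess n Q"
proof -
  have sub: "P \<subseteq> cube n" "Q \<subseteq> cube n" using assms by auto
  have fin: "finite P" "finite Q" using sub finite_subset_cube by auto
  have disj: "P \<inter> Q = {}" and A: "A = P \<union> Q" using P Q by auto
  have pos: "card P > 0" "card Q > 0" using fin assms by (auto simp: card_gt_0_iff)
  have "card {z \<in> P. flip i z \<in> Q} \<le> card P" using fin by (intro card_mono) auto
  moreover have "card {z \<in> Q. flip i z \<in> P} \<le> card Q" using fin by (intro card_mono) auto
  ultimately show mx: "m \<le> x"
    unfolding m_def x_def using card_flip_commute[OF sub assms(2)] by auto
  \<comment> \<open>A flip of any other coordinate leaves coordinate \<open>i\<close>, hence the part, unchanged.\<close>
  have "card {z \<in> P. flip j z \<in> Q} = (if j = i then card {z \<in> P. flip i z \<in> Q} else 0)" for j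
  proof (cases "j = i")
    case False
    then have "{z \<in> P. flip j z \<in> Q} = {}" using P Q flip_other[of i j] by auto
    then show ?thesis using False by (metis card.empty)
  qed auto
  then have "arcs n P Q = (\<Sum>j\<in>{1..n}. if j = i then card {z \<in> P. flip i z \<in> Q} else 0)"
    unfolding arcs_def by (intro sum.cong refl)
  then have "real (arcs n P Q) = m"
    unfolding m_def using assms(2) by simp
  then have arcs: "real (arcs n A A) = real (arcs n P P) + 2 * m + real (arcs n Q Q)"
    unfolding A using arcs_Un_self[OF sub disj] by simp
  have cA: "card A = card P + card Q" unfolding A using fin disj by (simp add: card_Un_disjoint)
  have xy: "0 < x" "x \<le> y" unfolding x_def y_def using pos by auto
  have "(x + y) * log 2 (x + y) - x * log 2 x - y * log 2 y
      = real (card A) * log 2 (real (card A)) - real (card P) * log 2 (real (card P))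
        - real (card Q) * log 2 (real (card Q))"
    unfolding x_def y_def cA by (auto simp: min_def max_def add.commute)
  then show gap: "excess n A \<ge> excess n P + excess n Q + 2 * (x - m) + (if 3 * x \<le> y then x else (y - x) / 4)"
    using entropy_gap[OF xy] arcs unfolding excess_def by (simp add: algebra_simps)
  show "excess n A \<ge> excess n P + excess n Q"
  proof (cases "3 * x \<le> y")
    case True
    show ?thesis using gap mx xy unfolding if_P[OF True] by argo
  next
    case False
    show ?thesis using gap mx xy unfolding if_not_P[OF False] by argo
  qed
qed

lemma arcs_subsingleton:
  assumes "A \<subseteq> {a}" shows "arcs n A A = 0"
proof -
  have "{x \<in> A. flip i x \<in> A} = {}" for i
    using assms flip_same_neq by (metis (no_types, lifting) empty_Collect_eq singletonD subsetD)
  then have "card {x \<in> A. flip i x \<in> A} = 0" for i by (metis card.empty)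
  then show ?thesis unfolding arcs_def by (intro sum.neutral ballI)
qed

lemma separating_coordinate:
  assumes "A \<subseteq> cube n" "\<not> (\<exists>a. A \<subseteq> {a})"
  obtains i b where "i \<in> {1..n}" "{x \<in> A. x i = b} \<noteq> {}" "{x \<in> A. x i \<noteq> b} \<noteq> {}"
proof -
  obtain x y where xy: "x \<in> A" "y \<in> A" "x \<noteq> y" using assms(2) by blast
  then obtain i where i: "i \<in> {1..n}" "x i \<noteq> y i" using cube_eqI assms(1) by blast
  then have "x \<in> {z \<in> A. z i = x i}" "y \<in> {z \<in> A. z i \<noteq> x i}" using xy by auto
  then show thesis using that[OF i(1)] by blast
qed

text \<open>The edge-isoperimetric inequality: cutting along a coordinate never increases the total excess.\<close>
theorem excess_nonneg:
  assumes "A \<subseteq> cube n" shows "excess n A \<ge> 0"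
  using finite_subset_cube[OF assms] assms
proof (induction rule: finite_psubset_induct)
  case (psubset A)
  show ?case
  proof (cases "\<exists>a. A \<subseteq> {a}")
    case True
    then have "card A = 0 \<or> card A = 1"
      by (metis card.empty card_1_singleton_iff subset_singletonD One_nat_def)
    then show ?thesis using True arcs_subsingleton by (auto simp: excess_def)
  next
    case False
    then obtain i b where i: "i \<in> {1..n}"
      and ne: "{x \<in> A. x i = b} \<noteq> {}" "{x \<in> A. x i \<noteq> b} \<noteq> {}"
      by (rule separating_coordinate[OF psubset.prems])
    define P where "P = {x \<in> A. x i = b}"
    define Q where "Q = {x \<in> A. x i \<noteq> b}"
    have ne': "P \<noteq> {}" "Q \<noteq> {}" using ne P_def Q_def by auto
    have "P \<subset> A" "Q \<subset> A" using ne P_def Q_def by auto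
    then have IH: "excess n P \<ge> 0" "excess n Q \<ge> 0" using psubset.IH psubset.prems by auto
    then show ?thesis using excess_split(3)[OF psubset.prems i P_def Q_def ne'] by linarith
  qed
qed

corollary arcs_self_le:
  "A \<subseteq> cube n \<Longrightarrow> real (arcs n A A) \<le> real (card A) * log 2 (real (card A))"
  using excess_nonneg[of A n] by (simp add: excess_def)

section \<open>Sets near a subcube\<close>

lemma subcube_subset: "is_subcube n C \<Longrightarrow> C \<subseteq> cube n"
  unfolding is_subcube_def by auto

text \<open>
  The local geometry of a subcube of dimension \<open>s\<close>: from a vertex of \<open>C\<close> exactly the \<open>s\<close> free
  directions stay in \<open>C\<close>, and from a vertex outside \<open>C\<close> at most one direction leads into \<open>C\<close>, since it
  has to repair every violated constraint at once.
\<close>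
lemma subcube_arcs:
  assumes "is_subcube n C"
  obtains s where "card C = 2 ^ s"
    and "\<And>D. D \<subseteq> C \<Longrightarrow> arcs n D C = s * card D"
    and "\<And>D. D \<subseteq> cube n \<Longrightarrow> D \<inter> C = {} \<Longrightarrow> arcs n D C \<le> card D"
proof -
  obtain I a where I: "I \<subseteq> {1..n}" "a \<in> I \<rightarrow> {0, 1}" and C: "C = {x \<in> cube n. \<forall>i\<in>I. x i = a i}"
    using assms unfolding is_subcube_def by blast
  let ?J = "{1..n} - I"
  show thesis
  proof (rule that[of "card ?J"])
    have "C = PiE {1..n} (\<lambda>i. if i \<in> I then {a i} else {0, 1})"
    proof (intro set_eqI iffI)
      fix x assume "x \<in> C"
      then show "x \<in> PiE {1..n} (\<lambda>i. if i \<in> I then {a i} else {0, 1})"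
        by (auto simp: C cube_def PiE_iff)
    next
      fix x assume "x \<in> PiE {1..n} (\<lambda>i. if i \<in> I then {a i} else {0, 1})"
      then have x: "x \<in> extensional {1..n}" "\<And>i. i \<in> {1..n} \<Longrightarrow> x i \<in> (if i \<in> I then {a i} else {0, 1})"
        unfolding PiE_iff by blast+
      have xa: "x i = a i" if "i \<in> I" for i using x(2)[of i] that I by auto
      have "x i \<in> {0, 1}" if "i \<in> {1..n}" for i
        using x(2)[OF that] xa[of i] I(2) by (cases "i \<in> I") (auto simp: Pi_iff)
      then show "x \<in> C" using x(1) xa by (simp add: C cube_def PiE_iff)
    qed
    then have "card C = (\<Prod>i\<in>{1..n}. card (if i \<in> I then {a i} else {0, 1::nat}))"
      by (simp add: card_PiE)
    also have "\<dots> = (\<Prod>i\<in>{1..n}. if i \<in> I then 1 else 2)"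
      by (intro prod.cong) auto
    also have "\<dots> = (\<Prod>i\<in>?J. 2)"
      by (intro prod.mono_neutral_cong_right) auto
    finally show "card C = 2 ^ card ?J" by simp
  next
    fix D assume D: "D \<subseteq> C"
    have "card {x \<in> D. flip i x \<in> C} = (if i \<in> ?J then card D else 0)" if "i \<in> {1..n}" for i
    proof (cases "i \<in> I")
      case True
      have "flip i x \<notin> C" if "x \<in> D" for x
      proof -
        have "x i = a i" using that True D C by auto
        then have "flip i x i \<noteq> a i" using flip_same_neq by metis
        then show ?thesis using True C by blast
      qed
      then have "{x \<in> D. flip i x \<in> C} = {}" by blast
      then show ?thesis using True by (metis DiffD2 card.empty)
    next
      case False
      then have "{x \<in> D. flip i x \<in> C} = D"
      proof (intro equalityI subsetI CollectI conjI)
        fix x assume x: "x \<in> D"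
        have "flip i x j = a j" if "j \<in> I" for j
          using that x D C False flip_other[of j i x] by (cases "j = i") auto
        then show "flip i x \<in> C" using x D C flip_in_cube[of x n i] that by blast
      qed auto
      then show ?thesis using False that by simp
    qed
    then have "arcs n D C = (\<Sum>i\<in>{1..n}. if i \<in> ?J then card D else 0)"
      unfolding arcs_def by (intro sum.cong) auto
    also have "\<dots> = (\<Sum>i\<in>?J. card D)"
      by (intro sum.mono_neutral_cong_right) auto
    finally show "arcs n D C = card ?J * card D" by simp
  next
    fix D assume D: "D \<subseteq> cube n" "D \<inter> C = {}"
    have finD: "finite D" using D finite_subset_cube by blast
    let ?P = "SIGMA i:{1..n}. {x \<in> D. flip i x \<in> C}"
    have "inj_on snd ?P"
    proof (rule inj_onI)
      fix p q assume p: "p \<in> ?P" and q: "q \<in> ?P" and e: "snd p = snd q"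
      obtain i x where px: "p = (i, x)" by force
      obtain j where qx: "q = (j, x)" using e px by (metis prod.collapse snd_conv)
      have x: "x \<in> D" "flip i x \<in> C" "flip j x \<in> C" using p q px qx by auto
      obtain k where "k \<in> I" "x k \<noteq> a k" using x(1) D C by blast
      moreover have "flip i x k = a k" "flip j x k = a k" using x(2,3) C \<open>k \<in> I\<close> by auto
      ultimately have "k = i" "k = j" using flip_other by metis+
      then show "p = q" using px qx by simp
    qed
    moreover have "snd ` ?P \<subseteq> D" by auto
    ultimately have "card ?P \<le> card D" using finD by (rule card_inj_on_le)
    then show "arcs n D C \<le> card D"
      unfolding arcs_def using finD by (subst (asm) card_SigmaI) auto
  qed
qed

text \<open>
  With \<open>K = A \<inter> C\<close>, the arcs inside \<open>K\<close> are computed exactly by removing \<open>D = C - A\<close> from the regular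
  graph \<open>C\<close>, up to the arcs inside \<open>D\<close>, which are bounded by the isoperimetric inequality. Each of the
  \<open>d'\<close> added vertices has at most one neighbour in \<open>K\<close>, which gives the term \<open>2 * d'\<close>.
\<close>
lemma arcs_le_near_subcube:
  assumes "A \<subseteq> cube n" "is_subcube n C"
  defines "d \<equiv> real (card (C - A))" and "d' \<equiv> real (card (A - C))"
  obtains s where "card C = 2 ^ s"
    and "real (arcs n A A) \<le> real s * 2 ^ s - 2 * real s * d + d * log 2 d + d' * log 2 d' + 2 * d'"
proof -
  obtain s where s: "card C = 2 ^ s"
    and inner: "\<And>D. D \<subseteq> C \<Longrightarrow> arcs n D C = s * card D"
    and outer: "\<And>D. D \<subseteq> cube n \<Longrightarrow> D \<inter> C = {} \<Longrightarrow> arcs n D C \<le> card D"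
    using subcube_arcs[OF assms(2)] by metis
  define K where "K = A \<inter> C"
  define D where "D = C - A"
  define D' where "D' = A - C"
  have sub: "K \<subseteq> cube n" "D \<subseteq> cube n" "D' \<subseteq> cube n"
    using assms subcube_subset[OF assms(2)] by (auto simp: K_def D_def D'_def)
  have fin: "finite K" "finite D" "finite D'" using sub finite_subset_cube by auto
  have C: "C = D \<union> K" "D \<inter> K = {}" and A: "A = D' \<union> K" "D' \<inter> K = {}"
    by (auto simp: K_def D_def D'_def)
  have "arcs n C C = arcs n D D + 2 * arcs n D K + arcs n K K"
    using arcs_Un_self[OF sub(2,1)] C by auto
  moreover have "arcs n D C = arcs n D D + arcs n D K"
    using arcs_Un_right[OF fin(2)] C by auto
  moreover have "arcs n C C = s * 2 ^ s" "arcs n D C = s * card D"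
    using inner s by (auto simp: D_def)
  ultimately have "s * 2 ^ s + arcs n D D = 2 * (s * card D) + arcs n K K" by linarith
  then have "real (s * 2 ^ s + arcs n D D) = real (2 * (s * card D) + arcs n K K)" by (rule arg_cong)
  then have KK: "real (arcs n K K) = real s * 2 ^ s - 2 * real s * d + real (arcs n D D)"
    by (simp add: d_def D_def)
  have "arcs n D' K \<le> arcs n D' C" using fin by (intro arcs_mono_right) (auto simp: K_def)
  also have "\<dots> \<le> card D'" using sub outer by (auto simp: D'_def)
  finally have "real (arcs n D' K) \<le> d'" by (simp add: d'_def D'_def)
  moreover have "arcs n A A = arcs n D' D' + 2 * arcs n D' K + arcs n K K"
    using arcs_Un_self[OF sub(3,1)] A by auto
  ultimately have "real (arcs n A A) \<le> real s * 2 ^ s - 2 * real s * d + d * log 2 d + d' * log 2 d' + 2 * d'"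
    using KK arcs_self_le[OF sub(2)] arcs_self_le[OF sub(3)]
    by (simp add: d_def d'_def D_def D'_def)
  with s show thesis using that by blast
qed

lemma card_sym_diff:
  assumes "finite A" "finite B"
  shows "card (sym_diff A B) = card (A - B) + card (B - A)"
    and "card A + card (B - A) = card B + card (A - B)"
proof -
  show "card (sym_diff A B) = card (A - B) + card (B - A)"
    using assms by (intro card_Un_disjoint) auto
  have "card A = card (A \<inter> B) + card (A - B)" "card B = card (A \<inter> B) + card (B - A)"
    using card_Int_Diff[OF assms(1), of B] card_Int_Diff[OF assms(2), of A]
    by (simp_all add: Int_commute)
  then show "card A + card (B - A) = card B + card (A - B)" by simp
qed

lemma mult_log_le_of_le_eighth:
  fixes d :: real
  assumes "0 \<le> d" "d \<le> 2 ^ s / 8"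
  shows "d * log 2 d \<le> d * (real s - 3)"
proof (cases "d = 0")
  case False
  then have "log 2 d \<le> log 2 (2 ^ s / 8)" using assms by (intro log_mono) auto
  also have "\<dots> = real s - log 2 (2 ^ 3)" by (simp add: log_divide log_nat_power)
  also have "\<dots> = real s - 3" by (subst log_nat_power) auto
  finally show ?thesis using assms by (intro mult_left_mono) auto
qed auto

text \<open>
  This turns a fixed bound on the distance to a subcube into one proportional to the excess. For
  \<open>d, d' \<le> 2^s / 8\<close> one has \<open>log d, log d' \<le> s - 3\<close>, so every deleted or added vertex costs a
  positive amount; the terms with factor \<open>s\<close> cancel.
\<close>
lemma sym_diff_le_excess:
  assumes "A \<subseteq> cube n" "is_subcube n C"
    and near: "real (card (sym_diff A C)) \<le> real (card C) / 8"
  shows "real (card (sym_diff A C)) \<le> excess n A"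
proof -
  have fin: "finite A" "finite C" using assms finite_subset_cube subcube_subset by blast+
  define d where "d = real (card (C - A))"
  define d' where "d' = real (card (A - C))"
  obtain s where s: "card C = 2 ^ s"
    and le: "real (arcs n A A) \<le> real s * 2 ^ s - 2 * real s * d + d * log 2 d + d' * log 2 d' + 2 * d'"
    using arcs_le_near_subcube[OF assms(1,2)] unfolding d_def d'_def by metis
  define N :: real where "N = 2 ^ s"
  define M where "M = real (card A)"
  have sd: "real (card (sym_diff A C)) = d + d'"
    using card_sym_diff(1)[OF fin] by (simp add: d_def d'_def)
  have "real (card A + card (C - A)) = real (card C + card (A - C))"
    using card_sym_diff(2)[OF fin] by (rule arg_cong)
  then have M: "M = N - d + d'" using s by (simp add: M_def N_def d_def d'_def)
  have nn: "d \<ge> 0" "d' \<ge> 0" "N > 0" by (auto simp: d_def d'_def N_def)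
  have small: "d + d' \<le> N / 8" using near sd s by (simp add: N_def)
  have Mpos: "M > 0" using M small nn by linarith
  have l2: "ln (2::real) \<ge> 1/2" "ln (2::real) > 0" using ln2_ge_two_thirds by auto
  \<comment> \<open>The tangent of \<open>z log z\<close> at \<open>z = N\<close> bounds \<open>M log M\<close> from below.\<close>
  have "ln (N / M) \<le> N / M - 1" using nn Mpos by (intro ln_le_minus_one) auto
  then have "M * ln (N / M) \<le> M * (N / M - 1)" using Mpos by (intro mult_left_mono) auto
  also have "\<dots> = N - M" using Mpos by (simp add: field_simps)
  also have "M * ln (N / M) = - M * ln (M / N)" using Mpos nn by (simp add: ln_div algebra_simps)
  finally have "M * ln (M / N) \<ge> M - N" by simp
  then have "M * ln (M / N) / ln 2 \<ge> (M - N) / ln 2"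
    using l2 by (intro divide_right_mono) auto
  then have "M * log 2 (M / N) \<ge> (M - N) / ln 2" unfolding log_def by simp
  moreover
  have "log 2 (M / N) = log 2 M - real s"
    using Mpos nn by (simp add: log_divide N_def log_nat_power)
  then have "M * log 2 (M / N) = M * log 2 M - M * real s" by (simp add: right_diff_distrib)
  moreover have "M - N = d' - d" using M by simp
  ultimately have "M * log 2 M \<ge> M * real s + (d' - d) / ln 2" by (simp add: algebra_simps)
  moreover have "d * log 2 d \<le> d * (real s - 3)" "d' * log 2 d' \<le> d' * (real s - 3)"
    using nn small by (intro mult_log_le_of_le_eighth; simp add: N_def)+
  moreover have "excess n A = M * log 2 M - real (arcs n A A)" by (simp add: excess_def M_def)
  ultimately have "excess n A \<ge> M * real s + (d' - d) / ln 2
      - (real s * N - 2 * real s * d + d * (real s - 3) + d' * (real s - 3) + 2 * d')"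
    using le by (simp add: N_def)
  then have "excess n A \<ge> 3 * d + d' + (d' - d) / ln 2" unfolding M by (simp add: algebra_simps)
  moreover have "(d' - d) / ln 2 \<ge> - 2 * d"
  proof -
    have "d * (1 / ln 2) \<le> d * 2" using l2 nn by (intro mult_left_mono) (auto simp: field_simps)
    moreover have "d' / ln 2 \<ge> 0" using l2 nn by simp
    ultimately show ?thesis by (simp add: diff_divide_distrib)
  qed
  ultimately show ?thesis using sd by linarith
qed

text \<open>
  Here \<open>d = d' = \<delta> |A| / 2\<close>, and the bound on the arcs simplifies to exactly this inequality.
  Equality occurs when \<open>D\<close> is a subcube of \<open>C\<close> and \<open>D'\<close> is a subcube of the same dimension, outside
  \<open>C\<close>, all of whose vertices have a neighbour in \<open>C - D\<close>.
\<close>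
lemma excess_ge_of_subcube_same_size:
  assumes "A \<subseteq> cube n" "is_subcube n C" "card C = card A"
  defines "\<delta> \<equiv> real (card (sym_diff A C)) / real (card A)"
  assumes "\<delta> > 0"
  shows "excess n A \<ge> real (card A) * (\<delta> * log 2 (1 / \<delta>))"
proof -
  have fin: "finite A" "finite C" using assms finite_subset_cube subcube_subset by blast+
  define d where "d = real (card (C - A))"
  have dd: "card (A - C) = card (C - A)" using card_sym_diff(2)[OF fin] assms(3) by simp
  obtain s where s: "card C = 2 ^ s"
    and le: "real (arcs n A A) \<le> real s * 2 ^ s - 2 * real s * d + d * log 2 d + d * log 2 d + 2 * d"
    using arcs_le_near_subcube[OF assms(1,2)] dd unfolding d_def by metis
  have delta: "\<delta> = 2 * d / 2 ^ s"
    using card_sym_diff(1)[OF fin] dd assms(3) s by (simp add: \<delta>_def d_def)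
  then have d: "d > 0" using assms(5) by (simp add: zero_less_divide_iff d_def)
  have "log 2 (1 / \<delta>) = real s - 1 - log 2 d"
    unfolding delta using d by (simp add: log_divide log_mult log_nat_power)
  then have "real (card A) * (\<delta> * log 2 (1 / \<delta>)) = 2 * d * (real s - 1 - log 2 d)"
    using delta s assms(3) by simp
  moreover have "excess n A = real s * 2 ^ s - real (arcs n A A)"
    using s assms(3) by (simp add: excess_def log_nat_power)
  ultimately show ?thesis using le by (simp add: algebra_simps)
qed

section \<open>Small excess forces a nearby subcube\<close>

lemma subcube_Un_flip:
  assumes "is_subcube n C" "i \<in> {1..n}"
  shows "is_subcube n (C \<union> flip i ` C)"
proof -
  obtain I a where I: "I \<subseteq> {1..n}" "a \<in> I \<rightarrow> {0, 1}" and C: "C = {x \<in> cube n. \<forall>i\<in>I. x i = a i}"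
    using assms unfolding is_subcube_def by blast
  have "C \<union> flip i ` C = {x \<in> cube n. \<forall>j\<in>I - {i}. x j = a j}"
  proof (intro equalityI subsetI)
    fix x assume "x \<in> C \<union> flip i ` C"
    then obtain y where y: "y \<in> C" "x = y \<or> x = flip i y" by blast
    then have "x \<in> cube n" using assms(2) flip_in_cube C by blast
    moreover have "x j = a j" if "j \<in> I - {i}" for j
      using y that C flip_other[of j i y] by auto
    ultimately show "x \<in> {x \<in> cube n. \<forall>j\<in>I - {i}. x j = a j}" by blast
  next
    fix x assume x: "x \<in> {x \<in> cube n. \<forall>j\<in>I - {i}. x j = a j}"
    show "x \<in> C \<union> flip i ` C"
    proof (cases "i \<in> I \<and> x i \<noteq> a i")
      case False
      then show ?thesis using x unfolding C by auto
    next
      case True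
      then have "a i = 0 \<or> a i = 1" using I by auto
      then have "flip i x i = a i"
        using True x cube_value[of x n i] assms(2) by (auto simp: flip_def)
      then have "flip i x j = a j" if "j \<in> I" for j
        using x that flip_other[of j i x] by (cases "j = i") auto
      then have "flip i x \<in> C" using x assms(2) flip_in_cube unfolding C by blast
      then show ?thesis using flip_flip x assms(2) by (metis (no_types, lifting) UnI2 imageI mem_Collect_eq)
    qed
  qed
  moreover have "I - {i} \<subseteq> {1..n}" "a \<in> I - {i} \<rightarrow> {0, 1}"
    using I unfolding Pi_iff by blast+
  ultimately show ?thesis unfolding is_subcube_def by blast
qed

lemma is_subcube_singleton:
  assumes "x \<in> cube n" shows "is_subcube n {x}"
proof -
  have "{x} = {y \<in> cube n. \<forall>i\<in>{1..n}. y i = x i}" using assms cube_eqI by blast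
  moreover have "x \<in> {1..n} \<rightarrow> {0, 1}" using cube_value[OF assms] by auto
  ultimately show ?thesis
    unfolding is_subcube_def by (intro exI[of _ "{1..n}"] exI[of _ x] conjI) simp_all
qed

lemma card_sym_diff_triangle:
  assumes "finite A" "finite B" "finite C"
  shows "card (sym_diff A C) \<le> card (sym_diff A B) + card (sym_diff B C)"
proof -
  have "card (sym_diff A C) \<le> card (sym_diff A B \<union> sym_diff B C)"
    using assms by (intro card_mono) auto
  also have "\<dots> \<le> card (sym_diff A B) + card (sym_diff B C)" by (rule card_Un_le)
  finally show ?thesis .
qed

text \<open>
  Doubling a subcube \<open>C\<close> near \<open>P\<close> approximates \<open>P \<union> Q\<close>, because the flip carries \<open>Q\<close> to a set that
  differs from \<open>P\<close> only in the unmatched vertices; the last bracket counts these on both sides.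
\<close>
lemma card_sym_diff_Un_flip:
  assumes "P \<subseteq> cube n" "Q \<subseteq> cube n" "C \<subseteq> cube n" "i \<in> {1..n}"
  shows "real (card (sym_diff (P \<union> Q) (C \<union> flip i ` C)))
     \<le> 2 * real (card (sym_diff P C)) + (real (card P) + real (card Q) - 2 * real (card {z \<in> P. flip i z \<in> Q}))"
proof -
  let ?Q = "flip i ` Q" and ?C = "flip i ` C"
  have sub: "?Q \<subseteq> cube n" "?C \<subseteq> cube n" using assms flip_in_cube by auto
  have fin: "finite P" "finite Q" "finite C" using assms finite_subset_cube by auto
  have inv: "flip i (flip i z) = z" if "z \<in> cube n" for z using flip_flip that assms(4) by blast
  have "(\<lambda>z. flip i (flip i z)) ` Q = (\<lambda>z. z) ` Q" using inv assms(2) by (intro image_cong) auto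
  then have QQ: "flip i ` ?Q = Q" by (simp add: image_image)
  have inj: "inj_on (flip i) (cube n)" using assms(4) by (intro inj_on_flip) auto
  have "flip i ` (?Q - C) = Q - ?C"
    using inj_on_image_set_diff[OF inj, of ?Q C] sub assms(3) unfolding QQ by blast
  moreover have "flip i ` (C - ?Q) = ?C - Q"
    using inj_on_image_set_diff[OF inj, of C ?Q] sub assms(3) unfolding QQ by blast
  ultimately have "sym_diff Q ?C = flip i ` sym_diff ?Q C" unfolding image_Un by simp
  then have "card (sym_diff Q ?C) \<le> card (sym_diff ?Q C)"
    using fin by (simp add: card_image_le)
  also have "\<dots> \<le> card (sym_diff ?Q P) + card (sym_diff P C)"
    using fin by (intro card_sym_diff_triangle) auto
  finally have 1: "card (sym_diff Q ?C) \<le> card (sym_diff ?Q P) + card (sym_diff P C)" .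
  have "z \<in> ?Q \<longleftrightarrow> flip i z \<in> Q" if "z \<in> P" for z
  proof
    assume "flip i z \<in> Q"
    then have "flip i (flip i z) \<in> ?Q" by blast
    then show "z \<in> ?Q" using inv that assms(1) by auto
  qed (use inv assms(2) in auto)
  then have "P \<inter> ?Q = {z \<in> P. flip i z \<in> Q}" by blast
  moreover have "card P = card (P \<inter> ?Q) + card (P - ?Q)" using fin by (intro card_Int_Diff)
  moreover have "card ?Q = card (P \<inter> ?Q) + card (?Q - P)"
    using fin card_Int_Diff[of ?Q P] by (simp add: Int_commute)
  moreover have "card ?Q = card Q" using inj_on_flip[OF assms(2,4)] by (rule card_image)
  moreover have "card (sym_diff ?Q P) = card (?Q - P) + card (P - ?Q)"
    by (rule card_sym_diff(1)) (use fin in auto)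
  ultimately have 2: "card (sym_diff ?Q P) + 2 * card {z \<in> P. flip i z \<in> Q} = card P + card Q" by simp
  have "card (sym_diff (P \<union> Q) (C \<union> ?C)) \<le> card (sym_diff P C \<union> sym_diff Q ?C)"
    using fin by (intro card_mono) auto
  also have "\<dots> \<le> card (sym_diff P C) + card (sym_diff Q ?C)" by (rule card_Un_le)
  finally have "card (sym_diff (P \<union> Q) (C \<union> ?C)) + 2 * card {z \<in> P. flip i z \<in> Q}
      \<le> 2 * card (sym_diff P C) + (card P + card Q)" using 1 2 by linarith
  then have "real (card (sym_diff (P \<union> Q) (C \<union> ?C)) + 2 * card {z \<in> P. flip i z \<in> Q})
      \<le> real (2 * card (sym_diff P C) + (card P + card Q))" by (rule of_nat_mono)
  then show ?thesis by simp
qed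

text \<open>
  Both cases of the induction produce a subcube at distance at most \<open>4 ex A\<close>, which is at most
  \<open>|A| / 9\<close>; this is where the constant \<open>36\<close> comes from.
\<close>
theorem small_excess_near_subcube:
  assumes "A \<subseteq> cube n" "A \<noteq> {}" "excess n A \<le> real (card A) / 36"
  shows "\<exists>C. is_subcube n C \<and> real (card (sym_diff A C)) \<le> real (card C) / 8"
  using finite_subset_cube[OF assms(1)] assms
proof (induction rule: finite_psubset_induct)
  case (psubset A)
  note A = psubset.prems(1)
  \<comment> \<open>Distance at most \<open>|A| / 9\<close> gives \<open>|C| \<ge> 8 |A| / 9\<close>, hence distance at most \<open>|C| / 8\<close>.\<close>
  have close: ?case if C: "is_subcube n C" "real (card (sym_diff A C)) \<le> 4 * excess n A" for C
  proof -
    have fin: "finite A" "finite C" using A C finite_subset_cube subcube_subset by blast+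
    have "card A \<le> card C + card (sym_diff A C)"
      using card_sym_diff[OF fin] by linarith
    then have "real (card A) \<le> real (card C) + real (card (sym_diff A C))"
      by (metis of_nat_add of_nat_mono)
    then show ?thesis using C psubset.prems(3) by (intro exI[of _ C]) auto
  qed
  show ?case
  proof (cases "\<exists>a. A \<subseteq> {a}")
    case True
    then obtain a where "A = {a}" using psubset.prems(2) by blast
    then show ?thesis using is_subcube_singleton[of a n] A by (intro exI[of _ "{a}"]) auto
  next
    case False
    then obtain i b where i: "i \<in> {1..n}"
      and ne: "{x \<in> A. x i = b} \<noteq> {}" "{x \<in> A. x i \<noteq> b} \<noteq> {}"
      by (rule separating_coordinate[OF A])
    define P0 where "P0 = {x \<in> A. x i = b}"
    define Q0 where "Q0 = {x \<in> A. x i \<noteq> b}"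
    define x where "x = min (real (card P0)) (real (card Q0))"
    define y where "y = max (real (card P0)) (real (card Q0))"
    define m where "m = real (card {z \<in> P0. flip i z \<in> Q0})"
    have ne0: "P0 \<noteq> {}" "Q0 \<noteq> {}" using ne P0_def Q0_def by auto
    have sub0: "P0 \<subseteq> cube n" "Q0 \<subseteq> cube n" and ps0: "P0 \<subset> A" "Q0 \<subset> A"
      and A0: "A = P0 \<union> Q0" "P0 \<inter> Q0 = {}"
      using A ne P0_def Q0_def by auto
    have fin0: "finite P0" "finite Q0" using sub0 finite_subset_cube by auto
    have cA: "real (card A) = real (card P0) + real (card Q0)"
      using A0 fin0 by (simp add: card_Un_disjoint)
    have xy: "0 < x" "x \<le> y" "x + y = real (card A)"
      using fin0 ne0 by (auto simp: x_def y_def cA card_gt_0_iff)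
    have mx: "m \<le> x" and split: "excess n A \<ge> excess n P0 + excess n Q0 + 2 * (x - m)
         + (if 3 * x \<le> y then x else (y - x) / 4)"
      using excess_split[OF A i P0_def Q0_def ne0] by (auto simp: x_def y_def m_def)
    have nn: "excess n P0 \<ge> 0" "excess n Q0 \<ge> 0" using sub0 excess_nonneg by auto
    show ?thesis
    proof (cases "3 * x \<le> y")
      case True
      \<comment> \<open>A very uneven cut: the small part \<open>Q\<close> has at most \<open>ex A\<close> vertices and is discarded. The excess
        left for \<open>P\<close> is smaller by at least \<open>|Q|\<close>, so it stays below \<open>|P| / 36\<close>.\<close>
      obtain P Q where PQ: "(P = P0 \<and> Q = Q0) \<or> (P = Q0 \<and> Q = P0)"
        and c: "real (card P) = y" "real (card Q) = x"
        unfolding x_def y_def by (metis linorder_linear max.absorb1 max.absorb2 min.absorb1 min.absorb2)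
      have P: "P \<subseteq> cube n" "P \<noteq> {}" "P \<subset> A" and AQ: "A = P \<union> Q"
        using PQ sub0 ne0 ps0 A0 by auto
      have exP: "excess n P + x \<le> excess n A"
        using split True nn mx PQ by auto
      then have "excess n P \<le> real (card P) / 36"
        using psubset.prems(3) xy c by linarith
      then obtain C where C: "is_subcube n C" "real (card (sym_diff P C)) \<le> real (card C) / 8"
        using psubset.IH P by blast
      have fin: "finite P" "finite Q" "finite C"
        using PQ fin0 C subcube_subset finite_subset_cube by blast+
      have "real (card (sym_diff P C)) \<le> excess n P" using sym_diff_le_excess P C by blast
      moreover have "card (sym_diff A C) \<le> card (sym_diff P C \<union> Q)"
        using fin AQ by (intro card_mono) auto
      then have "card (sym_diff A C) \<le> card (sym_diff P C) + card Q"
        using card_Un_le le_trans by blast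
      then have "real (card (sym_diff A C)) \<le> real (card (sym_diff P C)) + x"
        using c by (metis of_nat_add of_nat_mono)
      ultimately have "real (card (sym_diff A C)) \<le> 4 * excess n A"
        using exP excess_nonneg[OF A] by linarith
      then show ?thesis using close C by blast
    next
      case False
      \<comment> \<open>Two parts of comparable size: by averaging one of them, \<open>P\<close>, has relative excess at most
        \<open>1/36\<close>. It may be the smaller or the larger part.\<close>
      have "excess n P0 + excess n Q0 \<le> real (card A) / 36"
        using excess_split(3)[OF A i P0_def Q0_def ne0] psubset.prems(3) by linarith
      then have "excess n P0 \<le> real (card P0) / 36 \<or> excess n Q0 \<le> real (card Q0) / 36"
        using cA by linarith
      then obtain P Q where PQ: "(P = P0 \<and> Q = Q0) \<or> (P = Q0 \<and> Q = P0)"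
        and exP: "excess n P \<le> real (card P) / 36" by blast
      have P: "P \<subseteq> cube n" "P \<noteq> {}" "P \<subset> A" and AQ: "A = P \<union> Q" and Q: "Q \<subseteq> cube n"
        using PQ sub0 ne0 ps0 A0 by auto
      have mPQ: "real (card {z \<in> P. flip i z \<in> Q}) = m"
        using PQ card_flip_commute[OF sub0 i] by (auto simp: m_def)
      obtain C where C: "is_subcube n C" "real (card (sym_diff P C)) \<le> real (card C) / 8"
        using psubset.IH P exP by blast
      have "real (card (sym_diff P C)) \<le> excess n P" using sym_diff_le_excess P C by blast
      moreover have "real (card (sym_diff A (C \<union> flip i ` C)))
          \<le> 2 * real (card (sym_diff P C)) + (real (card P) + real (card Q) - 2 * m)"
        using card_sym_diff_Un_flip[OF P(1) Q subcube_subset[OF C(1)] i] mPQ AQ by simp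
      moreover have "real (card P) + real (card Q) = x + y"
        using PQ cA xy by auto
      moreover have "excess n P + 2 * (x - m) + (y - x) / 4 \<le> excess n A"
        using PQ split False nn by auto
      ultimately have "real (card (sym_diff A (C \<union> flip i ` C))) \<le> 4 * excess n A"
        using mx xy excess_nonneg[OF P(1)] by argo
      then show ?thesis using close subcube_Un_flip[OF C(1) i] by blast
    qed
  qed
qed

section \<open>Sets of size a power of two\<close>

lemma mult_log_inverse_mono:
  fixes x y :: real
  assumes "0 < x" "x \<le> y" "y \<le> 1/8"
  shows "x * log 2 (1 / x) \<le> y * log 2 (1 / y)"
proof -
  have l2: "ln (2::real) \<ge> 2/3" "ln (2::real) > 0" using ln2_ge_two_thirds by auto
  have "ln (8::real) = 3 * ln 2" using ln_realpow[of 2 3] by simp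
  moreover have "ln 8 \<le> ln (1 / y)" using assms by (subst ln_le_cancel_iff) (auto simp: field_simps)
  ultimately have "ln (1 / y) \<ge> 1" using l2 by linarith
  then have "(y - x) * 1 \<le> (y - x) * ln (1 / y)" using assms by (intro mult_left_mono) auto
  moreover have "x * ln (y / x) \<le> x * (y / x - 1)"
    using assms by (intro mult_left_mono ln_le_minus_one) auto
  moreover have "x * (y / x - 1) = y - x" using assms by (simp add: field_simps)
  moreover have "x * ln (1 / x) = x * ln (y / x) + x * ln (1 / y)"
    using assms by (simp add: ln_div algebra_simps)
  ultimately have "x * ln (1 / x) \<le> y * ln (1 / y)" by (simp add: algebra_simps)
  then show ?thesis using l2 unfolding log_def by (simp add: divide_right_mono)
qed

lemma mult_log_inverse_le_sqrt:
  fixes x :: real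
  assumes "0 < x"
  shows "x * log 2 (1 / x) \<le> 3 * sqrt x"
proof -
  have l2: "ln (2::real) \<ge> 2/3" "ln (2::real) > 0" using ln2_ge_two_thirds by auto
  have s: "sqrt x > 0" "x = sqrt x * sqrt x" using assms by auto
  have "ln (1 / sqrt x) \<le> 1 / sqrt x - 1" using s by (intro ln_le_minus_one) auto
  moreover have "ln (1 / x) = 2 * ln (1 / sqrt x)" using assms by (simp add: ln_div ln_sqrt)
  ultimately have "ln (1 / x) \<le> 2 / sqrt x" by simp
  then have "x * ln (1 / x) \<le> x * (2 / sqrt x)" using assms by (intro mult_left_mono) auto
  also have "\<dots> = 2 * (x / sqrt x)" by simp
  also have "\<dots> = 2 * sqrt x" using assms by (subst real_div_sqrt) auto
  also have "\<dots> \<le> 3 * sqrt x * ln 2" using s l2 by simp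
  finally show ?thesis using l2 unfolding log_def by (simp add: field_simps)
qed

lemma powers_of_two_close:
  assumes "(2::real) ^ s \<le> 2 ^ t * (9/8)" "(2::real) ^ t * (7/8) \<le> 2 ^ s"
  shows "s = t"
proof (rule ccontr)
  assume "s \<noteq> t"
  then consider "Suc s \<le> t" | "Suc t \<le> s" by linarith
  then have "2 * (2::real) ^ s \<le> 2 ^ t \<or> 2 * (2::real) ^ t \<le> 2 ^ s"
    using power_increasing[of "Suc s" t "2::real"] power_increasing[of "Suc t" s "2::real"]
    by cases auto
  moreover have "(2::real) ^ s > 0" "(2::real) ^ t > 0" by auto
  ultimately show False using assms by linarith
qed

text \<open>
  Either the excess exceeds \<open>|A| / 36\<close>, or \<open>A\<close> is near a subcube, which must have the size of \<open>A\<close>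
  because distinct powers of two differ by a factor of at least two; then the exact bound applies with
  \<open>\<gamma>\<close> between \<open>\<delta>\<close> and \<open>1/8\<close>.
\<close>
theorem excess_ge_of_far_from_subcubes:
  assumes "A \<subseteq> cube n" "card A = 2 ^ t" "\<delta> > 0" "far_from_subcubes n \<delta> A"
  shows "excess n A \<ge> real (card A) * min (\<delta> * log 2 (1 / \<delta>)) (1/36)"
proof (cases "excess n A \<le> real (card A) / 36")
  case False
  have "real (card A) * min (\<delta> * log 2 (1 / \<delta>)) (1/36) \<le> real (card A) * (1/36)"
    by (intro mult_left_mono) auto
  then show ?thesis using False by simp
next
  case True
  have ne: "A \<noteq> {}" using assms(2) by auto
  obtain C where C: "is_subcube n C" "real (card (sym_diff A C)) \<le> real (card C) / 8"
    using small_excess_near_subcube[OF assms(1) ne True] by blast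
  have fin: "finite A" "finite C" using assms C finite_subset_cube subcube_subset by blast+
  obtain s where s: "card C = 2 ^ s" using subcube_arcs[OF C(1)] by metis
  have "card A \<le> card C + card (sym_diff A C)" "card C \<le> card A + card (sym_diff A C)"
    using card_sym_diff[OF fin] by linarith+
  then have "real (card A) \<le> real (card C) + real (card (sym_diff A C))"
    "real (card C) \<le> real (card A) + real (card (sym_diff A C))"
    by (metis of_nat_add of_nat_mono)+
  then have "t = s" using C(2) assms(2) s by (intro powers_of_two_close) auto
  then have eq: "card C = card A" using s assms(2) by simp
  define \<gamma> where "\<gamma> = real (card (sym_diff A C)) / real (card A)"
  have "\<delta> * real (card A) \<le> real (card (sym_diff A C))"
    using assms(4) C unfolding far_from_subcubes_def by blast
  then have \<gamma>: "\<delta> \<le> \<gamma>" "\<gamma> \<le> 1/8" using assms(2) C(2) eq by (auto simp: \<gamma>_def field_simps)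
  have "real (card A) * min (\<delta> * log 2 (1 / \<delta>)) (1/36) \<le> real (card A) * (\<gamma> * log 2 (1 / \<gamma>))"
    using mult_log_inverse_mono[OF assms(3) \<gamma>] by (intro mult_left_mono) auto
  also have "\<dots> \<le> excess n A"
    using excess_ge_of_subcube_same_size[OF assms(1) C(1) eq] \<gamma> assms(3) by (simp add: \<gamma>_def)
  finally show ?thesis .
qed

theorem corollary10:
  shows "(\<exists>c::real. c > 0 \<and>
      (\<forall>(n::nat) (t::nat) (\<delta>::real) (A::(nat \<Rightarrow> nat) set).
         n \<ge> 1 \<longrightarrow> \<delta> > 0 \<longrightarrow> A \<subseteq> cube n \<longrightarrow> card A = 2 ^ t \<longrightarrow> far_from_subcubes n \<delta> A \<longrightarrow>
           real (card (edge_boundary n A))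
             \<ge> real (card A) * log 2 (2 ^ n / real (card A))
                + real (card A) * min (\<delta> * log 2 (1 / \<delta>)) c
           \<and> real (card A) * log 2 (2 ^ n / real (card A))
                + real (card A) * min (\<delta> * log 2 (1 / \<delta>)) c
             = 2 ^ t * (real n - real t + min (\<delta> * log 2 (1 / \<delta>)) c)))
    \<and> (\<exists>c'::real. c' > 0 \<and>
      (\<forall>(n::nat) (t::nat) (\<delta>::real) (A::(nat \<Rightarrow> nat) set).
         n \<ge> 1 \<longrightarrow> \<delta> > 0 \<longrightarrow> A \<subseteq> cube n \<longrightarrow> card A = 2 ^ t \<longrightarrow> far_from_subcubes n \<delta> A \<longrightarrow>
         \<delta> \<le> c' \<longrightarrow>
           real (card (edge_boundary n A))
             \<ge> real (card A) * log 2 (2 ^ n / real (card A))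
                + real (card A) * \<delta> * log 2 (1 / \<delta>)
           \<and> real (card A) * log 2 (2 ^ n / real (card A))
                + real (card A) * \<delta> * log 2 (1 / \<delta>)
             = 2 ^ t * (real n - real t + \<delta> * log 2 (1 / \<delta>))))"
proof -
  have size: "real (card A) * log 2 (2 ^ n / real (card A)) = 2 ^ t * (real n - real t)"
    if "card A = 2 ^ t" for n t and A :: "(nat \<Rightarrow> nat) set"
    using that by (simp add: log_divide log_nat_power)
  have bound: "real (card (edge_boundary n A)) \<ge> real (card A) * log 2 (2 ^ n / real (card A))
      + real (card A) * min (\<delta> * log 2 (1 / \<delta>)) (1/36)"
    if "\<delta> > 0" "A \<subseteq> cube n" "card A = 2 ^ t" "far_from_subcubes n \<delta> A" for n t \<delta> A
  proof -
    have "A \<noteq> {}" using that(3) by auto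
    then show ?thesis
      using card_edge_boundary_excess[OF that(2)] excess_ge_of_far_from_subcubes[OF that(2,3,1,4)]
      by simp
  qed
  \<comment> \<open>\<open>(1/108)\<^sup>2\<close> is where \<open>3 * sqrt \<delta>\<close> reaches \<open>1/36\<close>.\<close>
  have small: "min (\<delta> * log 2 (1 / \<delta>)) (1/36) = \<delta> * log 2 (1 / \<delta>)"
    if "0 < \<delta>" "\<delta> \<le> (1/108)\<^sup>2" for \<delta> :: real
  proof -
    have "sqrt \<delta> \<le> 1/108" using that by (intro real_le_lsqrt) auto
    then show ?thesis using mult_log_inverse_le_sqrt[OF that(1)] by simp
  qed
  have pos: "(1/36::real) > 0" "((1/108)\<^sup>2::real) > 0" by auto
  have min_eq: "real (card A) * log 2 (2 ^ n / real (card A)) + real (card A) * min (\<delta> * log 2 (1 / \<delta>)) (1/36)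
      = 2 ^ t * (real n - real t + min (\<delta> * log 2 (1 / \<delta>)) (1/36))"
    if "card A = 2 ^ t" for n t \<delta> and A :: "(nat \<Rightarrow> nat) set"
    using size[OF that] that by (simp add: distrib_left)
  have small_bound: "real (card (edge_boundary n A))
        \<ge> real (card A) * log 2 (2 ^ n / real (card A)) + real (card A) * \<delta> * log 2 (1 / \<delta>)
      \<and> real (card A) * log 2 (2 ^ n / real (card A)) + real (card A) * \<delta> * log 2 (1 / \<delta>)
        = 2 ^ t * (real n - real t + \<delta> * log 2 (1 / \<delta>))"
    if "\<delta> > 0" "A \<subseteq> cube n" "card A = 2 ^ t" "far_from_subcubes n \<delta> A" "\<delta> \<le> (1/108)\<^sup>2" for n t \<delta> A
    using bound[OF that(1-4)] size[OF that(3), of n] that(3) unfolding small[OF that(1,5)]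
    by (simp add: distrib_left mult.assoc)
  show ?thesis
  proof (rule conjI, goal_cases)
    case 1
    show ?case by (rule exI[of _ "1/36"], intro conjI allI impI pos(1) bound min_eq)
  next
    case 2
    show ?case by (rule exI[of _ "(1/108)\<^sup>2"], rule conjI[OF pos(2)], intro allI impI small_bound)
  qed
qed

end
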